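(* Let $d_{\max}\in[0,1)$. Fix a stage $k\in\{0,\dots,N-1\}$ and suppose that $h_k(u)>0$ for every $u\in\mathbb{R}^m\setminus\{\mathbf{0}\}$. Whenever $(V(k),V_{\max}(k))\in\mathcal{S}_{d_{\max}}$, a control action $u(k)\in\mathbb{R}^m$ keeps the successor state $(V(k+1),V_{\max}(k+1))$ in $\mathcal{S}_{d_{\max}}$ for every stage-$k$ return $x\in\mathcal{X}_k$ if and only if $$u(k)\in C(k)\Gamma_k.$$ Equivalently, there exists some $\gamma(k)\in\Gamma_k$ such that $$u(k)=C(k)\gamma(k)=M(k)V(k)\gamma(k).$$
   Context: Fix $N\ge1$, $m\ge1$, a cost vector $\varepsilon\in\mathbb{R}_+^m$ (componentwise nonnegative), and nonempty compact sets $\mathcal{X}_k\subset\mathbb{R}^m$, $k=0,\dots,N-1$. $|u|$ is the vector of componentwise absolute values; $\sigma_{\mathcal{X}}(z):=\sup_{x\in\mathcal{X}}z^\top x$; $\mathbb{R}_+=[0,\infty)$. Dynamics: from a state $(V(k),V_{\max}(k))$, under control $u(k)$ and return $x$, $V(k+1)=V(k)+u(k)^\top x-\varepsilon^\top|u(k)|$ and $V_{\max}(k+1)=\max\{V_{\max}(k),V(k+1)\}$. Drawdown-safe set: $\mathcal{S}_{d_{\max}}:=\{(v,w)\in\mathbb{R}_+^2: w>0,\ (1-d_{\max})w\le v\le w\}$. Percentage drawdown $d(k):=(V_{\max}(k)-V(k))/V_{\max}(k)$; drawdown modulator $M(k):=\dfrac{d_{\max}-d(k)}{1-d(k)}$;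 drawdown cushion $C(k):=M(k)V(k)=V(k)-(1-d_{\max})V_{\max}(k)$. Support-risk function: $h_k(u):=\sigma_{\mathcal{X}_k}(-u)+\varepsilon^\top|u|$, $u\in\mathbb{R}^m$. Normalized safe-action set: $\Gamma_k:=\{\gamma\in\mathbb{R}^m:h_k(\gamma)\le1\}$. For $c\ge0$, $c\Gamma_k:=\{c\gamma:\gamma\in\Gamma_k\}$. *)

theory Defs
  imports "HOL-Analysis.Analysis"
begin

text \<open>
  Vectors in $R^m$ are of type \<open>real ^ 'm\<close>; there \<open>\<bar>u\<bar>\<close> is the vector of componentwise absolute
  values and \<open>\<le>\<close> is the componentwise order. A state is a pair \<open>(v, w)\<close> of the current value
  $V(k)$ and the running maximum $V_{max}(k)$.
\<close>

definition support_fun :: "(real ^ 'm::finite) set \<Rightarrow> real ^ 'm \<Rightarrow> real" where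
  "support_fun X z = (SUP x\<in>X. z \<bullet> x)"

definition next_state ::
  "real ^ 'm::finite \<Rightarrow> real \<times> real \<Rightarrow> real ^ 'm \<Rightarrow> real ^ 'm \<Rightarrow> real \<times> real" where
  "next_state \<epsilon> s u x =
     (let v' = fst s + u \<bullet> x - \<epsilon> \<bullet> \<bar>u\<bar> in (v', max (snd s) v'))"

definition safe_set :: "real \<Rightarrow> (real \<times> real) set" where
  "safe_set dmax = {(v, w). v \<ge> 0 \<and> w \<ge> 0 \<and> w > 0 \<and> (1 - dmax) * w \<le> v \<and> v \<le> w}"

definition drawdown :: "real \<times> real \<Rightarrow> real" where
  "drawdown s = (snd s - fst s) / snd s"

definition modulator :: "real \<Rightarrow> real \<times> real \<Rightarrow> real" where
  "modulator dmax s = (dmax - drawdown s) / (1 - drawdown s)"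

definition cushion :: "real \<Rightarrow> real \<times> real \<Rightarrow> real" where
  "cushion dmax s = modulator dmax s * fst s"

lemma cushion_eq:
  assumes "v > 0" and "w > 0"
  shows "cushion dmax (v, w) = v - (1 - dmax) * w"
proof -
  have "1 - drawdown (v, w) = v / w" "dmax - drawdown (v, w) = (v - (1 - dmax) * w) / w"
    using assms by (simp_all add: drawdown_def field_simps)
  then show ?thesis
    using assms by (simp add: cushion_def modulator_def)
qed

text \<open>For \<open>dmax < 1\<close> every safe state has positive value, so no division by zero occurs above.\<close>

lemma cushion_safe:
  assumes "dmax < 1" and "(v, w) \<in> safe_set dmax"
  shows "cushion dmax (v, w) = v - (1 - dmax) * w"
proof (rule cushion_eq)
  show w: "w > 0"
    using assms by (simp add: safe_set_def)
  have "0 < (1 - dmax) * w"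
    using assms(1) w by simp
  then show "v > 0"
    using assms(2) by (simp add: safe_set_def)
qed

definition support_risk :: "real ^ 'm::finite \<Rightarrow> (real ^ 'm) set \<Rightarrow> real ^ 'm \<Rightarrow> real" where
  "support_risk \<epsilon> X u = support_fun X (- u) + \<epsilon> \<bullet> \<bar>u\<bar>"

definition safe_actions :: "real ^ 'm::finite \<Rightarrow> (real ^ 'm) set \<Rightarrow> (real ^ 'm) set" where
  "safe_actions \<epsilon> X = {\<gamma>. support_risk \<epsilon> X \<gamma> \<le> 1}"

end

theory Submission
  imports Defs
begin

text \<open>
  A control is safe iff in the worst case over the returns the value lost, \<open>support_risk \<epsilon> X u\<close>, does
  not exceed the cushion: raising the running maximum to the new value is harmless, since a state
  with zero drawdown is safe. Support risk is positively homogeneous, so for a positive cushion one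
  divides by it; for a zero cushion strict positivity off the origin leaves \<open>u = 0\<close> only.
\<close>

lemma support_fun_le_iff:
  assumes "compact X" "X \<noteq> {}"
  shows "support_fun X z \<le> b \<longleftrightarrow> (\<forall>x\<in>X. z \<bullet> x \<le> b)"
proof -
  \<comment> \<open>A real \<open>SUP\<close> is the least upper bound only for nonempty sets
    bounded above; the bound comes from compactness of \<open>X\<close>.\<close>
  have "bdd_above ((\<bullet>) z ` X)"
    by (intro bounded_imp_bdd_above compact_imp_bounded compact_continuous_image
        continuous_intros assms)
  then show ?thesis
    unfolding support_fun_def using assms(2) by (rule cSUP_le_iff[rotated])
qed

text \<open>Replaces the supremum by one linear inequality per return, so that the later arguments
  can work pointwise in \<open>x\<close>.\<close>

lemma support_risk_le_iff:
  assumes "compact X" "X \<noteq> {}"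
  shows "support_risk \<epsilon> X u \<le> b \<longleftrightarrow> (\<forall>x\<in>X. \<epsilon> \<bullet> \<bar>u\<bar> - u \<bullet> x \<le> b)"
  using support_fun_le_iff[OF assms, of "- u" "b - \<epsilon> \<bullet> \<bar>u\<bar>"]
  by (auto simp: support_risk_def algebra_simps)

lemma support_risk_scaleR_le_iff:
  assumes "compact X" "X \<noteq> {}" "c > 0"
  shows "support_risk \<epsilon> X (c *\<^sub>R \<gamma>) \<le> c * b \<longleftrightarrow> support_risk \<epsilon> X \<gamma> \<le> b"
proof -
  have "\<bar>c *\<^sub>R \<gamma>\<bar> = c *\<^sub>R \<bar>\<gamma>\<bar>"
    using assms(3) by (simp add: vec_eq_iff abs_vec_def abs_mult)
  then have "\<epsilon> \<bullet> \<bar>c *\<^sub>R \<gamma>\<bar> - (c *\<^sub>R \<gamma>) \<bullet> x = c * (\<epsilon> \<bullet> \<bar>\<gamma>\<bar> - \<gamma> \<bullet> x)" for x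
    by (simp add: algebra_simps)
  then show ?thesis
    using assms by (simp add: support_risk_le_iff)
qed

lemma support_risk_zero_le_iff:
  assumes "compact X" "X \<noteq> {}"
  shows "support_risk \<epsilon> X 0 \<le> b \<longleftrightarrow> 0 \<le> b"
  using assms by (auto simp: support_risk_le_iff)

lemma support_risk_le_iff_mem_scaled_safe_actions:
  assumes X: "compact X" "X \<noteq> {}"
    and pos: "\<And>z. z \<noteq> 0 \<Longrightarrow> support_risk \<epsilon> X z > 0"
    and "c \<ge> 0"
  shows "support_risk \<epsilon> X u \<le> c \<longleftrightarrow> u \<in> (\<lambda>\<gamma>. c *\<^sub>R \<gamma>) ` safe_actions \<epsilon> X"
proof (cases "c = 0")
  case True
  \<comment> \<open>Without a member of \<open>safe_actions\<close>, the image under multiplication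
    by 0 would be empty instead of the singleton of 0.\<close>
  have "0 \<in> safe_actions \<epsilon> X"
    by (simp add: safe_actions_def support_risk_zero_le_iff[OF X])
  \<comment> \<open>Strict positivity excludes every nonzero \<open>u\<close>, while the zero
    control has risk at most 0.\<close>
  moreover have "support_risk \<epsilon> X u \<le> 0 \<longleftrightarrow> u = 0"
    using pos[of u] support_risk_zero_le_iff[OF X, of \<epsilon> 0] by force
  ultimately show ?thesis
    using True by auto
next
  case False
  then have c: "c > 0"
    using assms(4) by simp
  have scale: "support_risk \<epsilon> X (c *\<^sub>R \<gamma>) \<le> c \<longleftrightarrow> \<gamma> \<in> safe_actions \<epsilon> X" for \<gamma>
    using support_risk_scaleR_le_iff[OF X c, of \<epsilon> \<gamma> 1] by (simp add: safe_actions_def)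
  have "u = c *\<^sub>R (inverse c *\<^sub>R u)"
    using c by simp
  then show ?thesis
    using scale by (metis (no_types, lifting) image_iff)
qed

text \<open>The only binding constraint is the floor set by the old maximum,
  \<open>(1 - dmax) * w \<le> v'\<close>; by \<open>cushion_safe\<close> this says that the loss is
  at most the cushion.\<close>

lemma next_state_safe_iff:
  assumes "0 \<le> dmax" "dmax < 1" and safe: "(v, w) \<in> safe_set dmax"
  shows "next_state \<epsilon> (v, w) u x \<in> safe_set dmax \<longleftrightarrow>
    \<epsilon> \<bullet> \<bar>u\<bar> - u \<bullet> x \<le> cushion dmax (v, w)"
proof -
  define v' where "v' = v + u \<bullet> x - \<epsilon> \<bullet> \<bar>u\<bar>"
  have w: "w > 0" and lower: "0 < (1 - dmax) * w"
    using safe assms(2) by (auto simp: safe_set_def)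
  have shrink: "(1 - dmax) * y \<le> y" if "y \<ge> 0" for y
    using that assms(1) by (simp add: algebra_simps)
  have "(v', max w v') \<in> safe_set dmax \<longleftrightarrow> (1 - dmax) * w \<le> v'"
  proof (cases "w \<le> v'")
    \<comment> \<open>At a new maximum both floors, from \<open>w\<close> and from
      \<open>v'\<close>, lie below \<open>v'\<close>, because \<open>dmax\<close> is
      nonnegative.\<close>
    case True
    then have "(1 - dmax) * w \<le> v'"
      using w shrink[of w] by linarith
    then show ?thesis
      using True w shrink[of v'] by (simp add: safe_set_def max_def)
  next
    \<comment> \<open>The maximum stays \<open>w\<close>. Its floor is positive, so a value above
      the floor is automatically nonnegative.\<close>
    case False
    then show ?thesis
      using w less_le_trans[OF lower, of v'] by (auto simp: safe_set_def)
  qed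
  then show ?thesis
    unfolding cushion_safe[OF assms(2) safe] next_state_def v'_def by (auto simp: Let_def)
qed

theorem theorem3p7:
  fixes N k :: nat
    and \<epsilon> :: "real ^ 'm::finite"
    and X :: "nat \<Rightarrow> (real ^ 'm) set"
    and dmax V Vmax :: real
    and u :: "real ^ 'm"
  assumes "N \<ge> 1"
    and "0 \<le> \<epsilon>"
    and "\<And>j. j < N \<Longrightarrow> compact (X j) \<and> X j \<noteq> {}"
    and "0 \<le> dmax" and "dmax < 1"
    and "k < N"
    and "\<And>z. z \<noteq> 0 \<Longrightarrow> support_risk \<epsilon> (X k) z > 0"
    and "(V, Vmax) \<in> safe_set dmax"
  shows "((\<forall>x\<in>X k. next_state \<epsilon> (V, Vmax) u x \<in> safe_set dmax) \<longleftrightarrow>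
            u \<in> (\<lambda>\<gamma>. cushion dmax (V, Vmax) *\<^sub>R \<gamma>) ` safe_actions \<epsilon> (X k))
       \<and> ((\<forall>x\<in>X k. next_state \<epsilon> (V, Vmax) u x \<in> safe_set dmax) \<longleftrightarrow>
            (\<exists>\<gamma>\<in>safe_actions \<epsilon> (X k).
               u = cushion dmax (V, Vmax) *\<^sub>R \<gamma> \<and>
               u = (modulator dmax (V, Vmax) * V) *\<^sub>R \<gamma>))"
proof -
  have X: "compact (X k)" "X k \<noteq> {}"
    using assms(3,6) by auto
  have "cushion dmax (V, Vmax) \<ge> 0"
    using assms(8) unfolding cushion_safe[OF assms(5,8)] by (simp add: safe_set_def)
  then have "(\<forall>x\<in>X k. next_state \<epsilon> (V, Vmax) u x \<in> safe_set dmax) \<longleftrightarrow>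
      u \<in> (\<lambda>\<gamma>. cushion dmax (V, Vmax) *\<^sub>R \<gamma>) ` safe_actions \<epsilon> (X k)"
    using support_risk_le_iff_mem_scaled_safe_actions[OF X assms(7)]
    by (simp add: next_state_safe_iff[OF assms(4,5,8)] support_risk_le_iff[OF X])
  then show ?thesis
    \<comment> \<open>The cushion is by definition \<open>modulator\<close> times value, so the
      second equivalence only unfolds membership in the image.\<close>
    by (auto simp: cushion_def)
qed

end
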